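(* Let $A$ be a finite set, let $F\colon A^{\mathbb{Z}}\to A^{\mathbb{Z}}$ be a cellular automaton, and let $\mu$ be a shift-ergodic Borel probability measure on $A^{\mathbb{Z}}$. If $F$ has at least one $\mu$-equicontinuous point, then the sequence of measures $(\mu_n)_{n\ge 1}$ defined by $\mu_n=\frac{1}{n}\sum_{i=0}^{n-1}\mu\circ F^{-i}$ converges vaguely to an $F$-invariant measure $\mu_c$.
   Context: $A^{\mathbb{Z}}$ is the set of bi-infinite sequences $x=(x_i)_{i\in\mathbb{Z}}$ with $x_i\in A$, with the product topology of the discrete topologies on $A$. The shift $\sigma\colon A^{\mathbb{Z}}\to A^{\mathbb{Z}}$ is $\sigma(x)=(x_{i+1})_{i\in\mathbb{Z}}$. A cellular automaton is a continuous map $F\colon A^{\mathbb{Z}}\to A^{\mathbb{Z}}$ commuting with $\sigma$. Here $\mathbb{N}=\{0,1,2,\dots\}$. For integers $i\le j$, $x(i,j)$ denotes the word $x_i\ldots x_j$. For an integer $n\ge 0$ and $x\in A^{\mathbb{Z}}$, let $C_n(x)=\{y\in A^{\mathbb{Z}} : y_j=x_j \text{ for all } -n\le j\le n\}$ and $B_n(x)=\{y\in A^{\mathbb{Z}} : F^i(y)(-n,n)=F^i(x)(-n,n)\text{ for all } i\in\mathbb{N}\}$. A point $x$ is $\mu$-equicontinuous if for all $m\in\mathbb{N}$, $\lim_{n\to\infty}\frac{\mu(C_n(x)\cap B_m(x))}{\mu(C_n(x))}=1$ (in particular $\mu(C_n(x))>0$ for all $n$, so that the quotients make sense). $\mu$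 is shift ergodic if it is $\sigma$-invariant and ergodic for $\sigma$; it is not assumed $F$-invariant. $\mu\circ F^{-i}$ is the image measure $E\mapsto\mu((F^{i})^{-1}(E))$. Vague convergence $\mu_n\to\mu_c$ means $\int f\,d\mu_n\to\int f\,d\mu_c$ for every continuous $f\colon A^{\mathbb{Z}}\to\mathbb{R}$. A measure $\nu$ is $F$-invariant if $\nu(F^{-1}(E))=\nu(E)$ for every Borel set $E$. *)

theory Defs
  imports "HOL-Probability.Probability"
begin

text \<open>
  The alphabet \<open>A\<close> is a type of class \<open>finite\<close> and \<open>discrete_topology\<close>, so that the library's
  topology on \<open>int \<Rightarrow> 'a\<close> is the product of the discrete topologies and \<open>borel\<close> is its Borel
  sigma-algebra.
\<close>

type_synonym 'a config = "int \<Rightarrow> 'a"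

definition shift :: "'a config \<Rightarrow> 'a config" where
  "shift x = (\<lambda>i. x (i + 1))"

definition cellular_automaton ::
  "('a::{finite, discrete_topology} config \<Rightarrow> 'a config) \<Rightarrow> bool" where
  "cellular_automaton F \<longleftrightarrow> continuous_on UNIV F \<and> F \<circ> shift = shift \<circ> F"

definition word :: "'a config \<Rightarrow> int \<Rightarrow> int \<Rightarrow> 'a list" where
  "word x i j = map x [i..j]"

definition cyl :: "nat \<Rightarrow> 'a config \<Rightarrow> 'a config set" where
  "cyl n x = {y. \<forall>j. - int n \<le> j \<and> j \<le> int n \<longrightarrow> y j = x j}"

definition orbit_cyl :: "('a config \<Rightarrow> 'a config) \<Rightarrow> nat \<Rightarrow> 'a config \<Rightarrow> 'a config set" where
  "orbit_cyl F n x =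
     {y. \<forall>i. word ((F ^^ i) y) (- int n) (int n) = word ((F ^^ i) x) (- int n) (int n)}"

definition mu_equicontinuous ::
  "'a config measure \<Rightarrow> ('a config \<Rightarrow> 'a config) \<Rightarrow> 'a config \<Rightarrow> bool" where
  "mu_equicontinuous \<mu> F x \<longleftrightarrow>
     (\<forall>n. measure \<mu> (cyl n x) > 0) \<and>
     (\<forall>m. (\<lambda>n. measure \<mu> (cyl n x \<inter> orbit_cyl F m x) / measure \<mu> (cyl n x)) \<longlonglongrightarrow> 1)"

definition borel_probability :: "'b::topological_space measure \<Rightarrow> bool" where
  "borel_probability \<mu> \<longleftrightarrow> prob_space \<mu> \<and> sets \<mu> = sets borel"

definition invariant_measure ::
  "('b::topological_space \<Rightarrow> 'b) \<Rightarrow> 'b measure \<Rightarrow> bool" where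
  "invariant_measure G \<nu> \<longleftrightarrow> (\<forall>E\<in>sets borel. emeasure \<nu> (G -` E) = emeasure \<nu> E)"

definition shift_ergodic :: "'a::{finite, discrete_topology} config measure \<Rightarrow> bool" where
  "shift_ergodic \<mu> \<longleftrightarrow> invariant_measure shift \<mu> \<and>
     (\<forall>E\<in>sets borel. shift -` E = E \<longrightarrow> measure \<mu> E = 0 \<or> measure \<mu> E = 1)"

text \<open>
  The library has no addition of measures, so the average of the image measures is given by its
  values on Borel sets. The lemma \<open>emeasure_mean_measure\<close> below confirms that for continuous \<open>F\<close>
  this set function is countably additive, so that \<open>measure_of\<close> does not return a zero measure.
\<close>

definition mean_measure ::
  "'b::topological_space measure \<Rightarrow> ('b \<Rightarrow> 'b) \<Rightarrow> nat \<Rightarrow> 'b measure" where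
  "mean_measure \<mu> F n = measure_of UNIV (sets borel)
     (\<lambda>E. ennreal (1 / real n) * (\<Sum>i<n. emeasure (distr \<mu> borel (F ^^ i)) E))"

definition vaguely_converges ::
  "(nat \<Rightarrow> 'b::topological_space measure) \<Rightarrow> 'b measure \<Rightarrow> bool" where
  "vaguely_converges M N \<longleftrightarrow>
     (\<forall>f :: 'b \<Rightarrow> real. continuous_on UNIV f \<longrightarrow>
        (\<lambda>n. integral\<^sup>L (M n) f) \<longlonglongrightarrow> integral\<^sup>L N f)"

lemma sets_mean_measure [simp]: "sets (mean_measure \<mu> F n) = sets borel"
  unfolding mean_measure_def by (metis sets.sets_measure_of_eq space_borel)

lemma emeasure_mean_measure:
  assumes "sets \<mu> = sets borel" "continuous_on UNIV F" "E \<in> sets borel"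
  shows "emeasure (mean_measure \<mu> F n) E =
    ennreal (1 / real n) * (\<Sum>i<n. emeasure \<mu> ((F ^^ i) -` E))"
proof -
  let ?g = "\<lambda>E. ennreal (1 / real n) * (\<Sum>i<n. emeasure (distr \<mu> borel (F ^^ i)) E)"
  have "countably_additive (sets borel) ?g"
  proof (rule countably_additiveI)
    fix B :: "nat \<Rightarrow> 'a set"
    assume B: "range B \<subseteq> sets borel" "disjoint_family B"
    have "(\<Sum>k. ?g (B k)) =
        ennreal (1 / real n) * (\<Sum>k. \<Sum>i<n. emeasure (distr \<mu> borel (F ^^ i)) (B k))"
      by (simp add: ennreal_suminf_cmult)
    also have "\<dots> = ennreal (1 / real n) * (\<Sum>i<n. \<Sum>k. emeasure (distr \<mu> borel (F ^^ i)) (B k))"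
      by (subst suminf_sum) auto
    also have "\<dots> = ?g (\<Union>k. B k)"
      using B by (simp add: suminf_emeasure)
    finally show "(\<Sum>k. ?g (B k)) = ?g (\<Union>k. B k)" .
  qed
  moreover have "positive (sets borel) ?g"
    by (simp add: positive_def)
  moreover have "sigma_algebra UNIV (sets (borel :: 'a measure))"
    by (metis sets.sigma_algebra_axioms space_borel)
  ultimately have "emeasure (mean_measure \<mu> F n) E = ?g E"
    unfolding mean_measure_def using assms(3)
    by (intro emeasure_measure_of_sigma) auto
  moreover have "emeasure (distr \<mu> borel (F ^^ i)) E = emeasure \<mu> ((F ^^ i) -` E)" for i
  proof -
    have "continuous_on UNIV (F ^^ i)"
    proof (induction i)
      case (Suc i)
      then show ?case
        using continuous_on_compose[of UNIV "F ^^ i" F] assms(2)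
          continuous_on_subset[of UNIV F] by auto
    qed (simp add: id_def)
    then have "F ^^ i \<in> measurable \<mu> borel"
      using borel_measurable_continuous_onI assms(1) measurable_cong_sets by blast
    then show ?thesis
      using assms by (simp add: emeasure_distr sets_eq_imp_space_eq[OF assms(1)])
  qed
  ultimately show ?thesis by simp
qed

end

theory Submission
  imports Defs
begin

text \<open>
  Let \<open>r\<close> be a radius of \<open>F\<close> and \<open>x\<close> a \<open>\<mu>\<close>-equicontinuous point. Then \<open>B\<^sub>r(x)\<close> has positive measure,
  so by ergodicity almost every \<open>y\<close> has shifts in \<open>B\<^sub>r(x)\<close> arbitrarily far to the right and to the
  left. The two columns so obtained are equal at all times and wide enough to block information,
  hence the orbit of \<open>y\<close> between them is the orbit of a spatially periodic configuration, which is
  ultimately periodic in time. Therefore the Cesaro means of the indicator of any clopen set \<open>C\<close>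
  converge along almost every orbit, and \<open>\<mu>\<^sub>n(C)\<close> converges by dominated convergence. By compactness
  the limit is a premeasure on the algebra of clopen sets; its Caratheodory extension is \<open>\<mu>\<^sub>c\<close>.
\<close>

section \<open>The topology of the configuration space\<close>

lemma cyl_eq_iff: "y \<in> cyl n x \<longleftrightarrow> (\<forall>j. \<bar>j\<bar> \<le> int n \<longrightarrow> y j = x j)"
proof -
  have "(- int n \<le> j \<and> j \<le> int n) = (\<bar>j\<bar> \<le> int n)" for j
    by linarith
  then show ?thesis by (simp add: cyl_def)
qed

lemma self_in_cyl [simp]: "x \<in> cyl n x"
  by (simp add: cyl_eq_iff)

lemma cyl_eq_of_mem: "y \<in> cyl n x \<Longrightarrow> cyl n y = cyl n x"
  by (auto simp: cyl_eq_iff)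

lemma cyl_antimono: "m \<le> n \<Longrightarrow> cyl n x \<subseteq> cyl m x"
  by (auto simp: cyl_eq_iff)

lemma open_cyl [simp]: "open (cyl n (x :: 'a::{finite, discrete_topology} config))"
proof -
  have "open {f :: 'a config. \<forall>i\<in>{- int n..int n}. f i \<in> {x i}}"
    by (rule product_topology_basis') (auto simp: Topological_Spaces.open_discrete)
  also have "{f. \<forall>i\<in>{- int n..int n}. f i \<in> {x i}} = cyl n x"
    by (auto simp: cyl_def)
  finally show ?thesis .
qed

text \<open>A basic open box constrains only finitely many coordinates, and these lie in one
  symmetric window.\<close>

lemma open_contains_cyl:
  fixes U :: "'a::{finite, discrete_topology} config set"
  assumes "open U" "x \<in> U"
  obtains n where "cyl n x \<subseteq> U"
proof -
  have "openin (product_topology (\<lambda>i. euclidean) UNIV) U"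
    using assms by (simp add: euclidean_product_topology)
  from product_topology_open_contains_basis[OF this \<open>x \<in> U\<close>]
  obtain X where X: "x \<in> (\<Pi>\<^sub>E i\<in>UNIV. X i)" "finite {i. X i \<noteq> UNIV}" "(\<Pi>\<^sub>E i\<in>UNIV. X i) \<subseteq> U"
    by auto
  \<comment> \<open>If no coordinate is constrained, this \<open>Max\<close> has no specified value;
    that is harmless, since the bound below speaks of constrained coordinates only.\<close>
  define k where "k = nat (Max (abs ` {i. X i \<noteq> UNIV}))"
  have k: "\<bar>i\<bar> \<le> int k" if "X i \<noteq> UNIV" for i
  proof -
    have "\<bar>i\<bar> \<le> Max (abs ` {i. X i \<noteq> UNIV})"
      using that X(2) by (intro Max_ge) auto
    then show ?thesis unfolding k_def by linarith
  qed
  have "cyl k x \<subseteq> (\<Pi>\<^sub>E i\<in>UNIV. X i)"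
  proof
    fix y assume y: "y \<in> cyl k x"
    have "y i \<in> X i" for i
    proof (cases "X i = UNIV")
      case False
      then have "y i = x i" using y k[of i] by (simp add: cyl_eq_iff)
      then show ?thesis using X(1) by auto
    qed simp
    then show "y \<in> (\<Pi>\<^sub>E i\<in>UNIV. X i)" by auto
  qed
  then show ?thesis using X(3) that by fast
qed

lemma compact_UNIV_config: "compact (UNIV :: 'a::{finite, discrete_topology} config set)"
proof -
  have "compact_space (product_topology (\<lambda>i::int. euclidean :: 'a topology) UNIV)"
    unfolding compact_space_product_topology
    by (simp add: compact_space_def compactin_euclidean_iff finite_imp_compact)
  then show ?thesis
    by (simp add: euclidean_product_topology compact_space_def compactin_euclidean_iff)
qed

text \<open>Cylinders behave like balls of an ultrametric: every point of a cylinder is a centre of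
  it. So the largest radius in a finite subcover by cylinders serves at every point.\<close>

lemma Lebesgue_number_cyl:
  fixes \<U> :: "'a::{finite, discrete_topology} config set set"
  assumes op: "\<And>U. U \<in> \<U> \<Longrightarrow> open U" and cov: "\<Union>\<U> = UNIV"
  shows "\<exists>m. \<forall>u. \<exists>U\<in>\<U>. cyl m u \<subseteq> U"
proof -
  have "\<exists>n. \<exists>U\<in>\<U>. cyl n x \<subseteq> U" for x
    using open_contains_cyl op cov by (metis UNIV_I Union_iff)
  then obtain n where n: "\<And>x. \<exists>U\<in>\<U>. cyl (n x) x \<subseteq> U"
    by metis
  obtain D where D: "finite D" "UNIV \<subseteq> (\<Union>x\<in>D. cyl (n x) x)"
  proof (rule compactE_image[OF compact_UNIV_config, of UNIV "\<lambda>x. cyl (n x) x"])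
    show "UNIV \<subseteq> (\<Union>x\<in>UNIV. cyl (n x) x)"
      using self_in_cyl by blast
    show thesis if "D \<subseteq> UNIV" "finite D" "UNIV \<subseteq> (\<Union>x\<in>D. cyl (n x) x)" for D
      using that(2,3) by (rule \<open>\<And>D. finite D \<Longrightarrow> UNIV \<subseteq> (\<Union>x\<in>D. cyl (n x) x) \<Longrightarrow> thesis\<close>)
  qed (rule open_cyl)
  obtain m where m: "\<And>x. x \<in> D \<Longrightarrow> n x \<le> m"
    using D(1) by (meson Max_ge finite_imageI imageI)
  have "\<exists>U\<in>\<U>. cyl m u \<subseteq> U" for u
  proof -
    obtain x where "x \<in> D" "u \<in> cyl (n x) x" using D(2) by auto
    then have "cyl m u \<subseteq> cyl (n x) x"
      using cyl_antimono[OF m] cyl_eq_of_mem by metis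
    then show ?thesis using n[of x] by blast
  qed
  then show ?thesis by blast
qed

text \<open>The fibres of \<open>h\<close> form an open cover. A cylinder of its Lebesgue radius
  lies in a single fibre, so one finite window decides \<open>h\<close> everywhere.\<close>

lemma locally_constant_window:
  fixes h :: "'a::{finite, discrete_topology} config \<Rightarrow> 'b"
  assumes "\<And>b. open (h -` {b})"
  obtains m where "\<And>u v. v \<in> cyl m u \<Longrightarrow> h v = h u"
proof -
  have "\<exists>m. \<forall>u. \<exists>U\<in>range (\<lambda>b. h -` {b}). cyl m u \<subseteq> U"
  proof (rule Lebesgue_number_cyl)
    show "open U" if "U \<in> range (\<lambda>b. h -` {b})" for U
      using that assms by (elim rangeE) simp
  qed auto
  then obtain m where m: "\<And>u. \<exists>U\<in>range (\<lambda>b. h -` {b}). cyl m u \<subseteq> U"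
    by blast
  have "h v = h u" if "v \<in> cyl m u" for u v
  proof -
    obtain b where "cyl m u \<subseteq> h -` {b}" using m[of u] by blast
    then have "v \<in> h -` {b}" "u \<in> h -` {b}" using that self_in_cyl[of u m] by blast+
    then show ?thesis by simp
  qed
  then show thesis using that by blast
qed

lemma finite_range_cyl: "finite (range (cyl n :: 'a::finite config \<Rightarrow> _))"
proof -
  let ?W = "{- int n..int n} \<rightarrow>\<^sub>E (UNIV :: 'a set)"
  have "range (cyl n) \<subseteq> cyl n ` ?W"
  proof
    fix C assume "C \<in> range (cyl n :: 'a config \<Rightarrow> _)"
    then obtain x :: "'a config" where "C = cyl n x" by auto
    \<comment> \<open>Every cylinder has a centre that is \<open>undefined\<close> off the window,
      and there are only finitely many such centres.\<close>
    then have "C = cyl n (restrict x {- int n..int n})"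
      by (auto simp: cyl_def)
    then show "C \<in> cyl n ` ?W" by auto
  qed
  then show ?thesis
    by (rule finite_subset) (intro finite_imageI finite_PiE; simp)
qed

section \<open>The algebra of clopen sets\<close>

definition clopens :: "'b::topological_space set set" where
  "clopens = {C. open C \<and> closed C}"

lemma clopens_algebra: "algebra UNIV clopens"
  by (auto simp: algebra_iff_Un clopens_def open_Compl closed_Compl open_Un closed_Un
      simp flip: Compl_eq_Diff_UNIV)

lemma clopens_subset_borel: "C \<in> clopens \<Longrightarrow> C \<in> sets borel"
  by (simp add: clopens_def)

lemma clopens_vimage: "continuous_on UNIV F \<Longrightarrow> C \<in> clopens \<Longrightarrow> F -` C \<in> clopens"
  by (simp add: clopens_def open_vimage closed_vimage)

text \<open>Both \<open>C\<close> and its complement are unions of cylinders of radius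
  \<open>m\<close>. Together with \<open>clopen_window\<close> this identifies the clopen sets with
  those decided by a finite window.\<close>

lemma cyl_determined_clopen:
  fixes C :: "'a::{finite, discrete_topology} config set"
  assumes "\<And>u v. v \<in> cyl m u \<Longrightarrow> v \<in> C \<longleftrightarrow> u \<in> C"
  shows "C \<in> clopens"
proof -
  have op: "open D" if D: "\<And>u v. v \<in> cyl m u \<Longrightarrow> v \<in> D \<longleftrightarrow> u \<in> D" for D :: "'a config set"
  proof (rule Topological_Spaces.openI)
    fix x assume "x \<in> D"
    then show "\<exists>T. open T \<and> x \<in> T \<and> T \<subseteq> D"
      using D by (intro exI[of _ "cyl m x"]) auto
  qed
  have "open C" "open (- C)" by (rule op; use assms in auto)+
  then show ?thesis by (simp add: clopens_def closed_def)
qed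

lemma cyl_clopen: "cyl n (x :: 'a::{finite, discrete_topology} config) \<in> clopens"
  by (rule cyl_determined_clopen[of n]) (auto simp: cyl_eq_iff)

text \<open>Membership in a clopen set is a locally constant predicate.\<close>

lemma clopen_window:
  fixes C :: "'a::{finite, discrete_topology} config set"
  assumes "C \<in> clopens"
  obtains m where "\<And>u v. v \<in> cyl m u \<Longrightarrow> v \<in> C \<longleftrightarrow> u \<in> C"
proof (rule locally_constant_window[of "\<lambda>u. u \<in> C"])
  fix b
  have "(\<lambda>u. u \<in> C) -` {b} = (if b then C else - C)"
    by auto
  then show "open ((\<lambda>u. u \<in> C) -` {b})"
    using assms by (simp add: clopens_def open_Compl)
next
  fix m assume "\<And>u v. v \<in> cyl m u \<Longrightarrow> (v \<in> C) = (u \<in> C)"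
  then show thesis by (rule that)
qed

text \<open>There are only countably many cylinders, so every open set is a countable union of
  clopen ones.\<close>

lemma borel_eq_clopens:
  "sets (borel :: 'a::{finite, discrete_topology} config measure) = sigma_sets UNIV clopens"
proof
  show "sigma_sets UNIV clopens \<subseteq> sets (borel :: 'a config measure)"
    using sets.sigma_sets_subset[of clopens "borel :: 'a config measure"] clopens_subset_borel
    by (auto simp: subset_iff)
  have "U \<in> sigma_sets UNIV clopens" if "open U" for U :: "'a config set"
  proof -
    let ?K = "{C \<in> (\<Union>n. range (cyl n)). C \<subseteq> U}"
    have "countable ?K"
      by (rule countable_subset[of _ "\<Union>n. range (cyl n)"])
        (auto intro: countable_finite finite_range_cyl)
    moreover have "?K \<subseteq> sigma_sets UNIV clopens"
      using cyl_clopen by (auto intro!: sigma_sets.Basic)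
    moreover have "\<Union>?K = U"
    proof
      show "U \<subseteq> \<Union>?K"
      proof
        fix x assume "x \<in> U"
        then obtain n where "cyl n x \<subseteq> U"
          using open_contains_cyl[OF \<open>open U\<close>] by metis
        then have "cyl n x \<in> ?K" by auto
        then show "x \<in> \<Union>?K"
          using self_in_cyl by (rule UnionI)
      qed
    qed auto
    ultimately show ?thesis
      using sigma_sets_UNION[of ?K UNIV clopens] by (simp only: subset_iff)
  qed
  then show "sets (borel :: 'a config measure) \<subseteq> sigma_sets UNIV clopens"
    unfolding borel_def by (subst sets_measure_of) (auto intro!: sigma_sets_mono)
qed

section \<open>Ultimately periodic sequences\<close>

definition ult_periodic :: "(nat \<Rightarrow> 'b) \<Rightarrow> bool" where
  "ult_periodic s \<longleftrightarrow> (\<exists>N q. q > 0 \<and> (\<forall>i\<ge>N. s (i + q) = s i))"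

lemma ult_periodic_map: "ult_periodic s \<Longrightarrow> ult_periodic (\<lambda>i. h (s i))"
  unfolding ult_periodic_def by metis

text \<open>Pigeonhole: some state recurs, and a deterministic orbit repeats itself from its first
  visit to that state on.\<close>

lemma ult_periodic_orbit:
  fixes F :: "'b \<Rightarrow> 'b"
  assumes "finite P" and "\<And>i. (F ^^ i) z \<in> P"
  shows "ult_periodic (\<lambda>i. (F ^^ i) z)"
proof -
  have "\<not> inj (\<lambda>i. (F ^^ i) z)"
    using assms by (metis (no_types, lifting) finite_subset image_subsetI range_inj_infinite)
  then obtain i j where ij: "i < j" "(F ^^ i) z = (F ^^ j) z"
    by (metis (mono_tags, lifting) injI nat_neq_iff)
  have "(F ^^ (k + (j - i))) z = (F ^^ k) z" if "k \<ge> i" for k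
  proof -
    have split: "(F ^^ (a + b)) z = (F ^^ a) ((F ^^ b) z)" for a b
      by (simp add: funpow_add)
    have "(F ^^ (k + (j - i))) z = (F ^^ (k - i)) ((F ^^ j) z)"
      using that ij(1) split[of "k - i" j] by simp
    also have "\<dots> = (F ^^ k) z"
      using that split[of "k - i" i] by (simp flip: ij(2))
    finally show ?thesis .
  qed
  then show ?thesis
    unfolding ult_periodic_def using ij(1) by (intro exI[of _ i] exI[of _ "j - i"]) auto
qed

text \<open>A term beyond index \<open>N + q\<close> equals the term \<open>q\<close> places
  earlier, so the terms up to \<open>N + q\<close> already attain all values.\<close>

lemma ult_periodic_bounded:
  fixes s :: "nat \<Rightarrow> real"
  assumes "ult_periodic s"
  obtains B where "\<And>i. \<bar>s i\<bar> \<le> B"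
proof -
  from assms obtain N q where q: "q > 0" "\<And>i. i \<ge> N \<Longrightarrow> s (i + q) = s i"
    unfolding ult_periodic_def by blast
  have "\<bar>s i\<bar> \<le> Max ((\<lambda>i. \<bar>s i\<bar>) ` {..N + q})" for i
  proof (induction i rule: less_induct)
    case (less i)
    show ?case
    proof (cases "i \<le> N + q")
      case False
      then have "s i = s (i - q)" using q(2)[of "i - q"] by simp
      then show ?thesis using less[of "i - q"] False q(1) by simp
    qed simp
  qed
  then show thesis using that by blast
qed

text \<open>From \<open>N\<close> on, the partial sums grow by a fixed amount \<open>c\<close> over
  every \<open>q\<close> steps. Removing a linear term of slope \<open>c / q\<close> leaves a
  bounded sequence, so the averages tend to \<open>c / q\<close>.\<close>

lemma ult_periodic_Cesaro:
  fixes s :: "nat \<Rightarrow> real"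
  assumes "ult_periodic s"
  shows "convergent (\<lambda>n. 1 / real n * (\<Sum>i<n. s i))"
proof -
  from assms obtain N q where q: "q > 0" "\<And>i. i \<ge> N \<Longrightarrow> s (i + q) = s i"
    unfolding ult_periodic_def by blast
  define S where "S n = (\<Sum>i<n. s i)" for n
  define c where "c = S (N + q) - S N"
  define D where "D n = S n - real n * (c / q)" for n
  have "S (n + q) - S n = c" if "n \<ge> N" for n
    using that
  proof (induction n rule: dec_induct)
    case (step n)
    then show ?case using q(2)[of n] by (simp add: S_def)
  qed (simp add: c_def)
  then have "D (n + q) = D n" if "n \<ge> N" for n
    using that q(1) by (simp add: D_def field_simps)
  then have "ult_periodic D"
    unfolding ult_periodic_def using q(1) by blast
  then obtain B where B: "\<And>n. \<bar>D n\<bar> \<le> B"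
    using ult_periodic_bounded by blast
  have "(\<lambda>n. D n * (1 / real n)) \<longlonglongrightarrow> 0"
  proof (rule Lim_null_comparison)
    show "\<forall>\<^sub>F n in sequentially. norm (D n * (1 / real n)) \<le> B * (1 / real n)"
      by (rule always_eventually) (auto simp: abs_mult intro!: divide_right_mono B)
    show "(\<lambda>n. B * (1 / real n)) \<longlonglongrightarrow> 0"
      by (intro tendsto_mult_right_zero lim_1_over_n)
  qed
  then have "(\<lambda>n. D n * (1 / real n) + c / q) \<longlonglongrightarrow> 0 + c / q"
    by (intro tendsto_add tendsto_const)
  moreover have "\<forall>\<^sub>F n in sequentially. D n * (1 / real n) + c / q = 1 / real n * S n"
    using eventually_gt_at_top[of 0] by eventually_elim (simp add: D_def field_simps)
  ultimately have "(\<lambda>n. 1 / real n * S n) \<longlonglongrightarrow> 0 + c / q"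
    by (rule Lim_transform_eventually)
  then show ?thesis unfolding S_def by (rule convergentI)
qed

section \<open>Cellular automata between equal columns\<close>

text \<open>The powers of the shift with integer exponents; the negative ones serve to find
  occurrences to the left.\<close>

definition translate :: "int \<Rightarrow> 'a config \<Rightarrow> 'a config" where
  "translate k x = (\<lambda>i. x (i + k))"

lemma translate_apply: "translate k x i = x (i + k)"
  by (simp add: translate_def)

lemma translate_translate [simp]: "translate k (translate l x) = translate (k + l) x"
  by (simp add: translate_def ac_simps)

lemma translate_0 [simp]: "translate 0 x = x"
  by (simp add: translate_def)

lemma shift_eq_translate: "shift = translate 1"
  by (simp add: fun_eq_iff shift_def translate_def)

lemma translate_commute:
  assumes "F \<circ> shift = shift \<circ> F"
  shows "F (translate k x) = translate k (F x)"
proof -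
  have nat: "F (translate (int n) x) = translate (int n) (F x)" for n x
  proof (induction n)
    case (Suc n)
    have "F (translate (int (Suc n)) x) = F (shift (translate (int n) x))"
      by (simp add: shift_eq_translate)
    also have "\<dots> = shift (F (translate (int n) x))"
      using fun_cong[OF assms] by simp
    finally show ?case using Suc by (simp add: shift_eq_translate)
  qed simp
  show ?thesis
  proof (cases "k \<ge> 0")
    case True
    then show ?thesis using nat[of "nat k"] by simp
  next
    case False
    \<comment> \<open>A negative translation is undone by a positive one, for which commutation is
      known.\<close>
    then have "F x = translate (- k) (F (translate k x))"
      using nat[of "nat (- k)" "translate k x"] by simp
    then show ?thesis by simp
  qed
qed

lemma translate_commute_funpow:
  fixes F :: "'a config \<Rightarrow> 'a config"
  assumes "F \<circ> shift = shift \<circ> F"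
  shows "(F ^^ i) (translate k x) = translate k ((F ^^ i) x)"
  by (induction i) (simp_all add: translate_commute[OF assms])

text \<open>The easy half of the Curtis-Hedlund-Lyndon theorem: coordinate 0 of the image is locally
  constant, hence decided by a finite window, and commutation with the shift carries this window to
  every coordinate.\<close>

lemma cellular_automaton_radius:
  fixes F :: "'a::{finite, discrete_topology} config \<Rightarrow> 'a config"
  assumes "cellular_automaton F"
  obtains r :: nat where "\<And>u v i. (\<And>j. \<bar>j - i\<bar> \<le> int r \<Longrightarrow> v j = u j) \<Longrightarrow> F v i = F u i"
proof -
  have cont: "continuous_on UNIV F" and comm: "F \<circ> shift = shift \<circ> F"
    using assms by (auto simp: cellular_automaton_def)
  have "open ((\<lambda>u. F u 0) -` {b})" for b
    by (rule open_vimage) (simp_all add: Topological_Spaces.open_discrete continuous_on_product_then_coordinatewise[OF cont])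
  then obtain r where r: "\<And>u v. v \<in> cyl r u \<Longrightarrow> F v 0 = F u 0"
    using locally_constant_window[of "\<lambda>u. F u 0"] by blast
  have "F v i = F u i" if "\<And>j. \<bar>j - i\<bar> \<le> int r \<Longrightarrow> v j = u j" for u v i
  proof -
    have "F (translate i v) 0 = F (translate i u) 0"
      by (rule r) (use that in \<open>auto simp: cyl_eq_iff translate_apply\<close>)
    then show ?thesis by (simp add: translate_commute[OF comm] translate_apply)
  qed
  then show thesis using that by blast
qed

text \<open>A configuration of period \<open>p\<close> is determined by its word on
  \<open>{0..<p}\<close>.\<close>

lemma finite_periodic_configs:
  assumes "p > 0"
  shows "finite {z :: 'a::finite config. translate p z = z}"
proof (rule inj_on_finite)
  show "finite ({0..<p} \<rightarrow>\<^sub>E (UNIV :: 'a set))" by (intro finite_PiE) auto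
  have per: "z (j mod p) = z j" if "translate p z = z" for z :: "'a config" and j
  proof -
    have "translate (int n * p) z = z" for n
    proof (induction n)
      case (Suc n)
      have "translate (int (Suc n) * p) z = translate p (translate (int n * p) z)"
        by (simp add: algebra_simps)
      then show ?case using Suc that by simp
    qed simp
    then have nat: "z (i + int n * p) = z i" for n i
      by (metis translate_apply)
    show ?thesis
    proof (cases "j div p \<ge> 0")
      case True
      then show ?thesis using nat[of "j mod p" "nat (j div p)"] by simp
    next
      case False
      then show ?thesis
        using nat[of j "nat (- (j div p))"] by (simp add: minus_div_mult_eq_mod)
    qed
  qed
  show "inj_on (\<lambda>z. restrict z {0..<p}) {z :: 'a config. translate p z = z}"
  proof (rule inj_onI, rule ext)
    fix z w :: "'a config" and j
    assume *: "z \<in> {z. translate p z = z}" "w \<in> {z. translate p z = z}"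
      "restrict z {0..<p} = restrict w {0..<p}"
    have "z (j mod p) = w (j mod p)"
      using fun_cong[OF *(3), of "j mod p"] assms by simp
    then show "z j = w j" using per[of z j] per[of w j] * by simp
  qed
qed auto

text \<open>Between the two equal columns \<open>y\<close> evolves like the spatially \<open>p\<close>-periodic configuration \<open>z\<close> that
  repeats \<open>y(0, p - 1)\<close>, and the orbit of \<open>z\<close> is finite.\<close>

lemma ult_periodic_between_columns:
  fixes F :: "'a::{finite, discrete_topology} config \<Rightarrow> 'a config"
  assumes comm: "F \<circ> shift = shift \<circ> F"
    and radius: "\<And>u v i. (\<And>j. \<bar>j - i\<bar> \<le> int r \<Longrightarrow> v j = u j) \<Longrightarrow> F v i = F u i"
    and p: "p > int r"
    and cols: "\<And>i j. \<bar>j\<bar> \<le> int r \<Longrightarrow> (F ^^ i) y (j + p) = (F ^^ i) y j"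
  shows "ult_periodic (\<lambda>i. restrict ((F ^^ i) y) {0..p})"
proof -
  define z where "z j = y (j mod p)" for j
  have z: "translate p z = z"
    by (simp add: fun_eq_iff translate_apply z_def)
  have per: "translate p ((F ^^ i) z) = (F ^^ i) z" for i
    using translate_commute_funpow[OF comm, of i p z] z by simp
  \<comment> \<open>Agreement on one period widens by \<open>r\<close> on both sides: moving by
    \<open>p\<close> preserves \<open>z\<close> by periodicity and \<open>y\<close> by equality of
    the columns. Since \<open>p > r\<close>, a position in either margin is moved into
    \<open>[0, p)\<close>.\<close>
  have extend: "(F ^^ i) z j = (F ^^ i) y j"
    if agree: "\<And>j. 0 \<le> j \<Longrightarrow> j < p \<Longrightarrow> (F ^^ i) z j = (F ^^ i) y j"
      and j: "- int r \<le> j" "j \<le> p + int r" for i j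
  proof -
    have per': "(F ^^ i) z (k + p) = (F ^^ i) z k" for k
      using fun_cong[OF per, of i k] by (simp add: translate_apply)
    consider "j < 0" | "0 \<le> j" "j < p" | "p \<le> j" by linarith
    then show ?thesis
    proof cases
      case 1
      have "(F ^^ i) z j = (F ^^ i) z (j + p)" by (simp add: per')
      also have "\<dots> = (F ^^ i) y (j + p)" by (rule agree) (use 1 j p in auto)
      also have "\<dots> = (F ^^ i) y j" by (rule cols) (use 1 j in auto)
      finally show ?thesis .
    next
      case 3
      have "(F ^^ i) z j = (F ^^ i) z (j - p)" using per'[of "j - p"] by simp
      also have "\<dots> = (F ^^ i) y (j - p)" by (rule agree) (use 3 j p in auto)
      also have "\<dots> = (F ^^ i) y j" using cols[of "j - p" i] 3 j by auto
      finally show ?thesis .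
    qed (rule agree)
  qed
  \<comment> \<open>Induction on time: one application of the local rule keeps the agreement on
    \<open>[0, p)\<close> only, and \<open>extend\<close> restores the lost margins.\<close>
  have main: "(F ^^ i) z j = (F ^^ i) y j" if "- int r \<le> j" "j \<le> p + int r" for i j
    using that
  proof (induction i arbitrary: j)
    case 0
    show ?case by (rule extend) (use 0 in \<open>auto simp: z_def\<close>)
  next
    case (Suc i)
    have "(F ^^ Suc i) z k = (F ^^ Suc i) y k" if "0 \<le> k" "k < p" for k
      unfolding funpow.simps comp_apply by (rule radius) (rule Suc.IH; use that in auto)
    then show ?case by (rule extend) (use Suc.prems in auto)
  qed
  have "ult_periodic (\<lambda>i. (F ^^ i) z)"
    by (rule ult_periodic_orbit[OF finite_periodic_configs[of p]]) (use p per in auto)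
  then have "ult_periodic (\<lambda>i. restrict ((F ^^ i) z) {0..p})"
    by (rule ult_periodic_map)
  also have "(\<lambda>i. restrict ((F ^^ i) z) {0..p}) = (\<lambda>i. restrict ((F ^^ i) y) {0..p})"
    using main by (auto simp: fun_eq_iff restrict_def)
  finally show ?thesis .
qed

section \<open>Measures determined by clopen sets\<close>

text \<open>The complements form an open cover. By compactness finitely many suffice, and a
  decreasing sequence is then empty from the largest of their indices on.\<close>

lemma decseq_clopens_empty:
  fixes A :: "nat \<Rightarrow> 'a::{finite, discrete_topology} config set"
  assumes "range A \<subseteq> clopens" "decseq A" "(\<Inter>i. A i) = {}"
  shows "\<exists>N. \<forall>n\<ge>N. A n = {}"
proof -
  have "(UNIV :: 'a config set) \<subseteq> (\<Union>i. - A i)"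
    using assms(3) by auto
  moreover have "open (- A i)" for i
    using assms(1) by (auto simp: clopens_def intro: open_Compl)
  ultimately obtain D where D: "finite D" "UNIV \<subseteq> (\<Union>i\<in>D. - A i)"
    using compactE_image[OF compact_UNIV_config, of UNIV "\<lambda>i. - A i"] by metis
  have "A n = {}" if "n \<ge> Max D" for n
  proof -
    have "A n \<subseteq> A i" if "i \<in> D" for i
      using decseqD[OF \<open>decseq A\<close>] Max_ge[OF D(1) that] \<open>n \<ge> Max D\<close> by simp
    then show ?thesis using D(2) by blast
  qed
  then show ?thesis by blast
qed

text \<open>Caratheodory extension: continuity at the empty set comes for free, because a decreasing
  sequence of clopen sets with empty intersection is eventually empty.\<close>

lemma clopen_content_extends:
  fixes L :: "'a::{finite, discrete_topology} config set \<Rightarrow> real"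
  assumes nonneg: "\<And>C. C \<in> clopens \<Longrightarrow> 0 \<le> L C"
    and add: "\<And>C D. C \<in> clopens \<Longrightarrow> D \<in> clopens \<Longrightarrow> C \<inter> D = {} \<Longrightarrow> L (C \<union> D) = L C + L D"
    and one: "L UNIV = 1"
  shows "\<exists>\<nu>. borel_probability \<nu> \<and> (\<forall>C\<in>clopens. measure \<nu> C = L C)"
proof -
  interpret algebra "UNIV :: 'a config set" clopens
    by (rule clopens_algebra)
  have "L {} = 0"
    using add[of "{}" "{}"] by simp
  have "\<exists>\<mu> :: 'a config set \<Rightarrow> ennreal. (\<forall>C\<in>clopens. \<mu> C = ennreal (L C)) \<and>
      measure_space UNIV (sigma_sets UNIV clopens) \<mu>"
  proof (rule caratheodory_empty_continuous)
    show "positive clopens (\<lambda>C. ennreal (L C))"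
      using \<open>L {} = 0\<close> by (simp add: positive_def)
    show "additive clopens (\<lambda>C. ennreal (L C))"
      by (auto simp: additive_def add nonneg ennreal_plus)
    fix A :: "nat \<Rightarrow> 'a config set"
    assume "range A \<subseteq> clopens" "decseq A" "(\<Inter>i. A i) = {}"
    then obtain N where "\<And>n. n \<ge> N \<Longrightarrow> A n = {}"
      using decseq_clopens_empty by blast
    then have "\<forall>\<^sub>F n in sequentially. ennreal (L (A n)) = 0"
      using \<open>L {} = 0\<close> unfolding eventually_sequentially by (intro exI[of _ N]) simp
    then show "(\<lambda>n. ennreal (L (A n))) \<longlonglongrightarrow> 0"
      by (rule tendsto_eventually)
  qed simp
  then obtain \<mu> :: "'a config set \<Rightarrow> ennreal" where
    \<mu>: "\<And>C. C \<in> clopens \<Longrightarrow> \<mu> C = ennreal (L C)" and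
    ms: "measure_space UNIV (sigma_sets UNIV clopens) \<mu>"
    by blast
  define \<nu> where "\<nu> = measure_of UNIV (sigma_sets UNIV clopens) \<mu>"
  have sets_\<nu>: "sets \<nu> = sigma_sets UNIV clopens"
    unfolding \<nu>_def by (simp add: sets_measure_of sigma_sets_sigma_sets_eq)
  have em: "emeasure \<nu> C = ennreal (L C)" if "C \<in> clopens" for C
    unfolding \<nu>_def using ms that \<mu>
    by (subst emeasure_measure_of_sigma) (auto simp: measure_space_def)
  have "space \<nu> = UNIV" by (simp add: \<nu>_def space_measure_of_conv)
  then have "prob_space \<nu>"
    using em[OF top] one by (intro prob_spaceI) simp
  then have "borel_probability \<nu>"
    by (simp add: borel_probability_def sets_\<nu> borel_eq_clopens)
  moreover have "measure \<nu> C = L C" if "C \<in> clopens" for C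
    using em[OF that] nonneg[OF that] by (simp add: measure_def)
  ultimately show ?thesis by blast
qed

text \<open>The clopen sets are closed under intersection and generate the Borel sets, so the image
  measure equals \<nu> once the two agree on them.\<close>

lemma invariant_measure_clopensI:
  fixes F :: "'a::{finite, discrete_topology} config \<Rightarrow> 'a config"
  assumes cont: "continuous_on UNIV F" and \<nu>: "borel_probability \<nu>"
    and inv: "\<And>C. C \<in> clopens \<Longrightarrow> measure \<nu> (F -` C) = measure \<nu> C"
  shows "invariant_measure F \<nu>"
proof -
  interpret prob_space \<nu> using \<nu> by (simp add: borel_probability_def)
  have sets: "sets \<nu> = sets borel" using \<nu> by (simp add: borel_probability_def)
  have space: "space \<nu> = UNIV" using sets_eq_imp_space_eq[OF sets] by simp
  have F: "F \<in> measurable \<nu> borel"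
    using borel_measurable_continuous_onI[OF cont] measurable_cong_sets[OF sets refl] by blast
  have distr: "emeasure (distr \<nu> borel F) E = emeasure \<nu> (F -` E)" if "E \<in> sets borel" for E
    using F that by (simp add: emeasure_distr space)
  have "distr \<nu> borel F = \<nu>"
  proof (rule measure_eqI_generator_eq[of clopens UNIV _ _ "\<lambda>_. UNIV"])
    show "Int_stable clopens"
      by (auto simp: Int_stable_def clopens_def)
    show "emeasure (distr \<nu> borel F) C = emeasure \<nu> C" if "C \<in> clopens" for C
      using distr[OF clopens_subset_borel[OF that]] inv[OF that] by (simp add: emeasure_eq_measure)
    show "range (\<lambda>_::nat. UNIV) \<subseteq> clopens"
      by (simp add: clopens_def)
    show "emeasure (distr \<nu> borel F) UNIV \<noteq> \<infinity>"
      using distr[of UNIV] by (simp add: emeasure_eq_measure)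
  qed (use sets in \<open>simp_all add: borel_eq_clopens\<close>)
  then show ?thesis
    using distr by (simp add: invariant_measure_def)
qed

section \<open>Vague convergence tested on clopen sets\<close>

lemma integrable_continuous_config:
  fixes f :: "'a::{finite, discrete_topology} config \<Rightarrow> real"
  assumes "finite_measure M" "sets M = sets borel" "continuous_on UNIV f"
  shows "integrable M f"
proof -
  interpret finite_measure M by fact
  obtain B where "\<And>u. norm (f u) \<le> B"
    using compact_imp_bounded[OF compact_continuous_image[OF assms(3) compact_UNIV_config]]
    by (auto simp: bounded_iff)
  moreover have "f \<in> borel_measurable M"
    using borel_measurable_continuous_onI[OF assms(3)] measurable_cong_sets[OF assms(2) refl] by blast
  ultimately show ?thesis
    by (intro integrable_const_bound[of _ B]) auto
qed

text \<open>A continuous \<open>f\<close> is uniformly close to a function \<open>g\<close> of a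
  finite window, whose integral is a finite combination of measures of clopen sets. The masses are
  only bounded by 1 because \<open>mean_measure\<close> with \<open>n = 0\<close> is the zero
  measure.\<close>

lemma vaguely_converges_clopensI:
  fixes M :: "nat \<Rightarrow> 'a::{finite, discrete_topology} config measure"
  assumes M: "\<And>n. finite_measure (M n)" "\<And>n. sets (M n) = sets borel" "\<And>n. measure (M n) UNIV \<le> 1"
    and N: "borel_probability N"
    and lim: "\<And>C. C \<in> clopens \<Longrightarrow> (\<lambda>n. measure (M n) C) \<longlonglongrightarrow> measure N C"
  shows "vaguely_converges M N"
  unfolding vaguely_converges_def
proof (intro allI impI)
  fix f :: "'a config \<Rightarrow> real"
  assume f: "continuous_on UNIV f"
  have N': "finite_measure N" "sets N = sets borel" "measure N UNIV \<le> 1"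
    using N by (auto simp: borel_probability_def prob_space_def intro: prob_space.prob_le_1)
  show "(\<lambda>n. integral\<^sup>L (M n) f) \<longlonglongrightarrow> integral\<^sup>L N f"
  proof (rule LIMSEQ_I)
    fix e :: real assume "e > 0"
    \<comment> \<open>The errors will be \<open>2 * d\<close> for each of the two replacements of
      \<open>f\<close> by \<open>g\<close> and less than \<open>d\<close> for the integrals of
      \<open>g\<close>, in total less than \<open>5 * d\<close>.\<close>
    define d where "d = e / 6"
    have "d > 0" using \<open>e > 0\<close> by (simp add: d_def)
    have "\<exists>m. \<forall>u. \<exists>U\<in>range (\<lambda>t. f -` ball t d). cyl m u \<subseteq> U"
    proof (rule Lebesgue_number_cyl)
      show "open U" if "U \<in> range (\<lambda>t. f -` ball t d)" for U
        using that f by (elim rangeE) (simp add: open_vimage)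
      have "u \<in> f -` ball (f u) d" for u
        using \<open>d > 0\<close> by simp
      then show "\<Union> (range (\<lambda>t. f -` ball t d)) = UNIV"
        by blast
    qed
    then obtain m where m: "\<And>u. \<exists>t. cyl m u \<subseteq> f -` ball t d"
      by blast
    have close: "\<bar>f v - f u\<bar> \<le> 2 * d" if v: "v \<in> cyl m u" for u v
    proof -
      obtain t where t: "cyl m u \<subseteq> f -` ball t d" using m by blast
      have "f v \<in> ball t d" "f u \<in> ball t d"
        using t v self_in_cyl[of u m] by blast+
      then show ?thesis by (simp add: dist_real_def)
    qed
    \<comment> \<open>\<open>f\<close> is evaluated at a representative that is
      \<open>undefined\<close> off the window, so \<open>g\<close> sees only the window and has
      finitely many values.\<close>
    define g where "g u = f (restrict u {- int m..int m})" for u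
    have g_cyl: "g v = g u" if "v \<in> cyl m u" for u v
    proof -
      have "restrict v {- int m..int m} = restrict u {- int m..int m}"
        using that by (auto simp: cyl_def restrict_def)
      then show ?thesis by (simp add: g_def)
    qed
    have fg: "\<bar>g u - f u\<bar> \<le> 2 * d" for u
      unfolding g_def by (rule close) (auto simp: cyl_def)
    have fin: "finite (range g)"
    proof (rule finite_subset)
      show "range g \<subseteq> f ` ({- int m..int m} \<rightarrow>\<^sub>E UNIV)"
        by (auto simp: g_def)
      show "finite (f ` ({- int m..int m} \<rightarrow>\<^sub>E UNIV))"
        by (intro finite_imageI finite_PiE) auto
    qed
    have level: "g -` {t} \<in> clopens" for t
      by (rule cyl_determined_clopen[of m]) (use g_cyl in auto)
    have "g -` B \<in> clopens" for B
      by (rule cyl_determined_clopen[of m]) (use g_cyl in auto)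
    then have g_cont: "continuous_on UNIV g"
      by (simp add: continuous_on_open_vimage[OF open_UNIV] clopens_def)
    have g_sum: "g u = (\<Sum>t\<in>range g. t * indicator (g -` {t}) u)" for u
    proof -
      have "(\<Sum>t\<in>range g. t * indicator (g -` {t}) u) = (\<Sum>t\<in>range g. if t = g u then t else 0)"
        by (intro sum.cong) (auto simp: indicator_def)
      then show ?thesis using fin by simp
    qed
    have int_g: "integral\<^sup>L K g = (\<Sum>t\<in>range g. t * measure K (g -` {t}))"
      if K: "finite_measure K" "sets K = sets borel" for K
    proof -
      interpret finite_measure K by fact
      have space: "space K = UNIV" using sets_eq_imp_space_eq[OF K(2)] by simp
      have lev: "g -` {t} \<in> sets K" for t
        using clopens_subset_borel[OF level] K(2) by simp
      have "integral\<^sup>L K g = (\<integral>u. (\<Sum>t\<in>range g. t * indicator (g -` {t}) u) \<partial>K)"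
        by (rule Bochner_Integration.integral_cong[OF refl g_sum])
      also have "\<dots> = (\<Sum>t\<in>range g. \<integral>u. t * indicator (g -` {t}) u \<partial>K)"
        using lev by (intro Bochner_Integration.integral_sum integrable_mult_right)
          (simp add: integrable_indicator_iff emeasure_eq_measure)
      also have "\<dots> = (\<Sum>t\<in>range g. t * measure K (g -` {t}))"
        using lev by (simp add: space)
      finally show ?thesis .
    qed
    have diff: "\<bar>integral\<^sup>L K g - integral\<^sup>L K f\<bar> \<le> 2 * d"
      if K: "finite_measure K" "sets K = sets borel" "measure K UNIV \<le> 1" for K
    proof -
      interpret finite_measure K by fact
      have space: "space K = UNIV" using sets_eq_imp_space_eq[OF K(2)] by simp
      have int: "integrable K g" "integrable K f"
        using integrable_continuous_config K f g_cont by blast+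
      then have "\<bar>integral\<^sup>L K g - integral\<^sup>L K f\<bar> = \<bar>\<integral>u. g u - f u \<partial>K\<bar>"
        by simp
      also have "\<dots> \<le> (\<integral>u. \<bar>g u - f u\<bar> \<partial>K)"
        by (rule integral_abs_bound)
      also have "\<dots> \<le> (\<integral>u. 2 * d \<partial>K)"
        using int fg by (intro integral_mono) auto
      also have "\<dots> \<le> 2 * d"
        using K(3) \<open>d > 0\<close> by (simp add: space mult_left_le_one_le)
      finally show ?thesis .
    qed
    have "(\<lambda>n. integral\<^sup>L (M n) g) \<longlonglongrightarrow> integral\<^sup>L N g"
      using int_g[OF M(1,2)] int_g[OF N'(1,2)]
      by (simp, intro tendsto_sum tendsto_mult_left lim level)
    then obtain n\<^sub>0 where n\<^sub>0: "\<And>n. n \<ge> n\<^sub>0 \<Longrightarrow> \<bar>integral\<^sup>L (M n) g - integral\<^sup>L N g\<bar> < d"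
      using \<open>d > 0\<close> LIMSEQ_D by (metis real_norm_def)
    have "norm (integral\<^sup>L (M n) f - integral\<^sup>L N f) < e" if "n \<ge> n\<^sub>0" for n
      using n\<^sub>0[OF that] diff[OF M, of n] diff[OF N'] \<open>d > 0\<close> unfolding real_norm_def d_def by linarith
    then show "\<exists>n\<^sub>0. \<forall>n\<ge>n\<^sub>0. norm (integral\<^sup>L (M n) f - integral\<^sup>L N f) < e"
      by blast
  qed
qed

section \<open>Recurrence under the shift\<close>

lemma continuous_translate [simp]: "continuous_on UNIV (translate k :: 'a::topological_space config \<Rightarrow> _)"
  unfolding translate_def by (intro continuous_on_coordinatewise_then_product) simp

lemma translate_vimage_borel:
  "E \<in> sets borel \<Longrightarrow> translate k -` E \<in> sets (borel :: 'a::topological_space config measure)"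
  using measurable_sets[OF borel_measurable_continuous_onI[OF continuous_translate], of E k] by simp

lemma measure_translate_vimage:
  fixes \<mu> :: "'a::topological_space config measure"
  assumes inv: "invariant_measure shift \<mu>" and E: "E \<in> sets borel"
  shows "measure \<mu> (translate k -` E) = measure \<mu> E"
proof -
  have nat: "measure \<mu> (translate (int n) -` E) = measure \<mu> E" if "E \<in> sets borel" for n E
  proof (induction n)
    case (Suc n)
    have "translate (int (Suc n)) -` E = shift -` (translate (int n) -` E)"
      by (auto simp: shift_eq_translate add.commute)
    then show ?case
      using Suc inv translate_vimage_borel[OF that, of "int n"]
      by (simp add: invariant_measure_def measure_def)
  qed (simp add: vimage_def)
  show ?thesis
  proof (cases "k \<ge> 0")
    case True
    then show ?thesis using nat[OF E, of "nat k"] by simp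
  next
    case False
    \<comment> \<open>For negative \<open>k\<close> the nonnegative case is applied to the preimage
      of \<open>E\<close>, with exponent \<open>- k\<close>.\<close>
    have "translate (- k) -` translate k -` E = E"
      by (auto simp: vimage_def)
    then show ?thesis
      using nat[OF translate_vimage_borel[OF E], of "nat (- k)" k] False by simp
  qed
qed

text \<open>The set of points with visits to \<open>E\<close> arbitrarily far in the direction
  \<open>s\<close> is shift invariant and has at least the measure of \<open>E\<close>; ergodicity
  makes it a set of full measure. The sign \<open>s\<close> treats right and left at once.\<close>

lemma AE_recurrent:
  fixes \<mu> :: "'a::{finite, discrete_topology} config measure"
  assumes \<mu>: "borel_probability \<mu>" "shift_ergodic \<mu>"
    and E: "E \<in> sets borel" "measure \<mu> E > 0"
    and s: "\<bar>s\<bar> = (1::int)"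
  shows "AE y in \<mu>. \<forall>N. \<exists>k. s * k \<ge> N \<and> translate k y \<in> E"
proof -
  interpret prob_space \<mu> using \<mu> by (simp add: borel_probability_def)
  have sets: "sets \<mu> = sets borel" using \<mu> by (simp add: borel_probability_def)
  have space: "space \<mu> = UNIV" using sets_eq_imp_space_eq[OF sets] by simp
  have ss: "s * s = 1" using s by (metis abs_mult_self_eq mult_1)
  define A where "A n = (\<Union>k\<in>{k. s * k \<ge> int n}. translate k -` E)" for n
  define H where "H = (\<Inter>n. A n)"
  have A: "A n \<in> sets borel" for n
    unfolding A_def by (intro sets.countable_UN'') (auto intro: translate_vimage_borel E)
  then have H: "H \<in> sets borel"
    unfolding H_def by (intro sets.countable_INT'') auto
  have "(\<lambda>n. measure \<mu> (A n)) \<longlonglongrightarrow> measure \<mu> H"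
    unfolding H_def
  proof (rule finite_Lim_measure_decseq)
    show "decseq A"
      by (rule decseq_SucI, unfold A_def, rule UN_mono) auto
  qed (use A sets in auto)
  moreover have "measure \<mu> E \<le> measure \<mu> (A n)" for n
  proof -
    \<comment> \<open>One translated copy of \<open>E\<close> suffices; it has the measure of
      \<open>E\<close>. Its index is admissible because \<open>s * s = 1\<close>.\<close>
    have "translate (s * int n) -` E \<subseteq> A n"
      using ss by (auto simp: A_def mult.assoc[symmetric] intro!: exI[of _ "s * int n"])
    then show ?thesis
      using finite_measure_mono[of _ "A n"] A sets measure_translate_vimage[of \<mu> E] E \<mu>
      by (metis shift_ergodic_def)
  qed
  ultimately have "measure \<mu> H \<ge> measure \<mu> E"
    by (intro LIMSEQ_le_const) auto
  have H_iff: "y \<in> H \<longleftrightarrow> (\<forall>N. \<exists>k. s * k \<ge> N \<and> translate k y \<in> E)" for y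
  proof
    assume y: "y \<in> H"
    show "\<forall>N. \<exists>k. s * k \<ge> N \<and> translate k y \<in> E"
    proof
      fix N
      have "y \<in> A (nat N)" using y by (auto simp: H_def)
      then obtain k where k: "s * k \<ge> int (nat N)" "translate k y \<in> E"
        by (auto simp: A_def)
      then have "s * k \<ge> N" by linarith
      then show "\<exists>k. s * k \<ge> N \<and> translate k y \<in> E"
        using k(2) by blast
    qed
  qed (auto simp: H_def A_def)
  have "shift -` H = H"
  proof -
    have "shift y \<in> H \<longleftrightarrow> y \<in> H" for y
    proof
      assume y: "shift y \<in> H"
      show "y \<in> H" unfolding H_iff
      proof
        fix N
        \<comment> \<open>The spare 1 absorbs the change of the index by one, whichever sign
          \<open>s\<close> has.\<close>
        obtain k where k: "s * k \<ge> N + 1" "translate k (shift y) \<in> E"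
          using y[unfolded H_iff] by blast
        have "s * (k + 1) \<ge> N"
          using k(1) s unfolding distrib_left by linarith
        then show "\<exists>k. s * k \<ge> N \<and> translate k y \<in> E"
          using k(2) by (intro exI[of _ "k + 1"]) (simp add: shift_eq_translate)
      qed
    next
      assume y: "y \<in> H"
      show "shift y \<in> H" unfolding H_iff
      proof
        fix N
        obtain k where k: "s * k \<ge> N + 1" "translate k y \<in> E"
          using y[unfolded H_iff] by blast
        have "s * (k - 1) \<ge> N"
          using k(1) s unfolding right_diff_distrib by linarith
        then show "\<exists>k. s * k \<ge> N \<and> translate k (shift y) \<in> E"
          using k(2) by (intro exI[of _ "k - 1"]) (simp add: shift_eq_translate)
      qed
    qed
    then show ?thesis by auto
  qed
  then have "measure \<mu> H = 0 \<or> measure \<mu> H = 1"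
    using \<mu>(2) H unfolding shift_ergodic_def by blast
  then have "measure \<mu> H = 1"
    using E(2) \<open>measure \<mu> H \<ge> measure \<mu> E\<close> by linarith
  then have "AE y in \<mu>. y \<in> H"
    using H sets by (intro prob_eq_1[THEN iffD1]) auto
  then show ?thesis by (simp add: H_iff)
qed

section \<open>Convergence of the averages\<close>

lemma continuous_on_funpow:
  fixes F :: "'b::topological_space \<Rightarrow> 'b"
  assumes "continuous_on UNIV F"
  shows "continuous_on UNIV (F ^^ i)"
proof (induction i)
  case (Suc i)
  have "continuous_on (range (F ^^ i)) F"
    using assms continuous_on_subset by blast
  then show ?case
    using continuous_on_compose[OF Suc] by simp
qed (simp add: id_def)

text \<open>It is an intersection, over all times, of preimages of cylinders under continuous maps,
  hence closed.\<close>

lemma orbit_cyl_borel: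
  fixes F :: "'a::{finite, discrete_topology} config \<Rightarrow> 'a config"
  assumes "continuous_on UNIV F"
  shows "orbit_cyl F m x \<in> sets borel"
proof -
  have word: "word y (- int m) (int m) = word z (- int m) (int m) \<longleftrightarrow> y \<in> cyl m z" for y z :: "'a config"
    by (auto simp: word_def cyl_def)
  have "orbit_cyl F m x = (\<Inter>i. (F ^^ i) -` cyl m ((F ^^ i) x))"
    by (auto simp: orbit_cyl_def word)
  also have "closed \<dots>"
  proof (intro closed_INT ballI closed_vimage)
    show "closed (cyl m z)" for z :: "'a config"
      using cyl_clopen[of m z] by (simp add: clopens_def)
  qed (rule continuous_on_funpow[OF assms])
  finally show ?thesis by simp
qed

text \<open>Almost every \<open>y\<close> enters \<open>orbit_cyl F r x\<close> after translations
  far to the right and far to the left. At both places it carries the central column of the orbit of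
  \<open>x\<close>, so \<open>ult_periodic_between_columns\<close> applies to the stretch between
  them.\<close>

lemma AE_ult_periodic_columns:
  fixes F :: "'a::{finite, discrete_topology} config \<Rightarrow> 'a config"
  assumes F: "cellular_automaton F" and \<mu>: "borel_probability \<mu>" "shift_ergodic \<mu>"
    and x: "mu_equicontinuous \<mu> F x"
  shows "AE y in \<mu>. \<forall>m. ult_periodic (\<lambda>i. restrict ((F ^^ i) y) {- int m..int m})"
proof -
  interpret prob_space \<mu> using \<mu> by (simp add: borel_probability_def)
  have sets: "sets \<mu> = sets borel" using \<mu> by (simp add: borel_probability_def)
  have cont: "continuous_on UNIV F" and comm: "F \<circ> shift = shift \<circ> F"
    using F by (auto simp: cellular_automaton_def)
  obtain r where r: "\<And>u v i. (\<And>j. \<bar>j - i\<bar> \<le> int r \<Longrightarrow> v j = u j) \<Longrightarrow> F v i = F u i"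
    using cellular_automaton_radius[OF F] by metis
  define E where "E = orbit_cyl F r x"
  have E: "E \<in> sets borel"
    unfolding E_def by (rule orbit_cyl_borel[OF cont])
  \<comment> \<open>If \<open>E\<close> were null, all quotients in the definition of equicontinuity
    would vanish and could not tend to 1.\<close>
  have "measure \<mu> E > 0"
  proof (rule ccontr)
    assume "\<not> measure \<mu> E > 0"
    then have "measure \<mu> E = 0" by (simp add: less_le)
    then have "measure \<mu> (cyl n x \<inter> E) = 0" for n
      using finite_measure_mono[of "cyl n x \<inter> E" E] E sets by (auto simp: measure_le_0_iff)
    moreover have "(\<lambda>n. measure \<mu> (cyl n x \<inter> E) / measure \<mu> (cyl n x)) \<longlonglongrightarrow> 1"
      using x by (simp add: mu_equicontinuous_def E_def)
    ultimately show False by (simp add: LIMSEQ_const_iff)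
  qed
  have E_col: "(F ^^ i) w j = (F ^^ i) x j" if "w \<in> E" "\<bar>j\<bar> \<le> int r" for w i j
  proof -
    have "map ((F ^^ i) w) [- int r..int r] = map ((F ^^ i) x) [- int r..int r]"
      using that(1) by (auto simp: E_def orbit_cyl_def word_def)
    moreover have "- int r \<le> j" "j \<le> int r" using that(2) by linarith+
    ultimately show ?thesis by simp
  qed
  have main: "ult_periodic (\<lambda>i. restrict ((F ^^ i) y) {- int m..int m})"
    if R: "\<forall>N. \<exists>k. 1 * k \<ge> N \<and> translate k y \<in> E" and L: "\<forall>N. \<exists>k. - 1 * k \<ge> N \<and> translate k y \<in> E"
    for y m
  proof -
    \<comment> \<open>The bounds on \<open>k\<close> and \<open>l\<close> place
      \<open>[-m, m]\<close> between the two column centres and make their distance \<open>p\<close>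
      exceed \<open>r\<close>.\<close>
    obtain k where k: "k \<ge> int m + int r + 1" "translate k y \<in> E" using R by auto
    obtain l where l: "- l \<ge> int m" "translate l y \<in> E" using L by auto
    define p where "p = k - l"
    have "ult_periodic (\<lambda>i. restrict ((F ^^ i) (translate l y)) {0..p})"
    proof (rule ult_periodic_between_columns[OF comm r])
      show "int r < p" using k l by (simp add: p_def)
      fix i j assume j: "\<bar>j\<bar> \<le> int r"
      have "(F ^^ i) (translate l y) (j + p) = (F ^^ i) (translate k y) j"
        by (simp add: translate_commute_funpow[OF comm] translate_apply p_def algebra_simps)
      then show "(F ^^ i) (translate l y) (j + p) = (F ^^ i) (translate l y) j"
        using E_col[OF k(2) j] E_col[OF l(2) j] by simp
    qed
    \<comment> \<open>Translating back by \<open>- l\<close> turns \<open>{0..p}\<close> into the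
      interval from \<open>l\<close> to \<open>k\<close>, which contains the window, so the window
      of \<open>y\<close> is a function of the periodic data.\<close>
    then have "ult_periodic (\<lambda>i. restrict (translate (- l) (restrict ((F ^^ i) (translate l y)) {0..p}))
        {- int m..int m})"
      by (rule ult_periodic_map)
    also have "(\<lambda>i. restrict (translate (- l) (restrict ((F ^^ i) (translate l y)) {0..p}))
        {- int m..int m}) = (\<lambda>i. restrict ((F ^^ i) y) {- int m..int m})"
      using k l by (auto simp: fun_eq_iff translate_commute_funpow[OF comm] translate_apply p_def
          restrict_def)
    finally show ?thesis .
  qed
  have "AE y in \<mu>. \<forall>N. \<exists>k. 1 * k \<ge> N \<and> translate k y \<in> E"
    by (rule AE_recurrent[OF \<mu> E \<open>measure \<mu> E > 0\<close>]) simp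
  moreover have "AE y in \<mu>. \<forall>N. \<exists>k. - 1 * k \<ge> N \<and> translate k y \<in> E"
    by (rule AE_recurrent[OF \<mu> E \<open>measure \<mu> E > 0\<close>]) simp
  ultimately show ?thesis
    by eventually_elim (use main in blast)
qed

section \<open>The averages on clopen sets\<close>

lemma measure_mean_measure:
  assumes "borel_probability \<mu>" "continuous_on UNIV F" "E \<in> sets borel"
  shows "measure (mean_measure \<mu> F n) E = 1 / real n * (\<Sum>i<n. measure \<mu> ((F ^^ i) -` E))"
    and "emeasure (mean_measure \<mu> F n) E \<noteq> \<infinity>"
proof -
  interpret prob_space \<mu> using assms by (simp add: borel_probability_def)
  have "emeasure (mean_measure \<mu> F n) E =
      ennreal (1 / real n * (\<Sum>i<n. measure \<mu> ((F ^^ i) -` E)))"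
    using assms
    by (subst emeasure_mean_measure)
      (simp_all add: borel_probability_def emeasure_eq_measure sum_nonneg flip: ennreal_mult)
  moreover have "0 \<le> 1 / real n * (\<Sum>i<n. measure \<mu> ((F ^^ i) -` E))"
    by (intro mult_nonneg_nonneg sum_nonneg) auto
  ultimately show "measure (mean_measure \<mu> F n) E = 1 / real n * (\<Sum>i<n. measure \<mu> ((F ^^ i) -` E))"
    and "emeasure (mean_measure \<mu> F n) E \<noteq> \<infinity>"
    by (simp_all add: measure_def)
qed

text \<open>The measure in question is the integral of the fraction of the first \<open>n\<close>
  times at which the orbit is in \<open>C\<close>. These fractions are bounded by 1 and converge
  almost everywhere.\<close>

lemma mean_measure_clopen_convergent:
  fixes F :: "'a::{finite, discrete_topology} config \<Rightarrow> 'a config"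
  assumes F: "cellular_automaton F" and \<mu>: "borel_probability \<mu>" "shift_ergodic \<mu>"
    and x: "mu_equicontinuous \<mu> F x" and C: "C \<in> clopens"
  shows "convergent (\<lambda>n. measure (mean_measure \<mu> F n) C)"
proof -
  interpret prob_space \<mu> using \<mu> by (simp add: borel_probability_def)
  have sets: "sets \<mu> = sets borel" using \<mu> by (simp add: borel_probability_def)
  have space: "space \<mu> = UNIV" using sets_eq_imp_space_eq[OF sets] by simp
  have cont: "continuous_on UNIV F"
    using F by (auto simp: cellular_automaton_def)
  define a where "a n y = 1 / real n * (\<Sum>i<n. indicat_real ((F ^^ i) -` C) y)" for n y
  have vC: "(F ^^ i) -` C \<in> sets \<mu>" for i
    using clopens_subset_borel[OF clopens_vimage[OF continuous_on_funpow[OF cont] C]] sets by simp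
  have int: "(\<integral>y. a n y \<partial>\<mu>) = measure (mean_measure \<mu> F n) C" for n
    using vC unfolding a_def measure_mean_measure(1)[OF \<mu>(1) cont clopens_subset_borel[OF C]]
    by (subst integral_mult_right_zero, subst Bochner_Integration.integral_sum)
      (auto simp: space integrable_indicator_iff emeasure_eq_measure)
  have conv: "AE y in \<mu>. convergent (\<lambda>n. a n y)"
    using AE_ult_periodic_columns[OF F \<mu> x]
  proof eventually_elim
    case (elim y)
    obtain m where m: "\<And>u v. v \<in> cyl m u \<Longrightarrow> v \<in> C \<longleftrightarrow> u \<in> C"
      using clopen_window[OF C] by metis
    \<comment> \<open>Replacing the coordinates off the window by \<open>undefined\<close> does not
      affect membership in \<open>C\<close>.\<close>
    have "ult_periodic (\<lambda>i. indicat_real C (restrict ((F ^^ i) y) {- int m..int m}))"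
      using ult_periodic_map[of _ "indicat_real C"] elim by blast
    also have "(\<lambda>i. indicat_real C (restrict ((F ^^ i) y) {- int m..int m})) =
        (\<lambda>i. indicat_real ((F ^^ i) -` C) y)"
    proof
      fix i
      have "restrict ((F ^^ i) y) {- int m..int m} \<in> cyl m ((F ^^ i) y)"
        by (auto simp: cyl_def)
      from m[OF this] show "indicat_real C (restrict ((F ^^ i) y) {- int m..int m}) =
          indicat_real ((F ^^ i) -` C) y"
        by (simp add: indicator_def)
    qed
    finally show ?case
      unfolding a_def by (rule ult_periodic_Cesaro)
  qed
  have meas: "a n \<in> borel_measurable \<mu>" for n
    unfolding a_def using vC by measurable
  \<comment> \<open>Where the averages diverge, \<open>lim\<close> has an unspecified value; this
    concerns a null set, and the limit function is measurable all the same.\<close>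
  have "(\<lambda>n. \<integral>y. a n y \<partial>\<mu>) \<longlonglongrightarrow> (\<integral>y. lim (\<lambda>n. a n y) \<partial>\<mu>)"
  proof (rule integral_dominated_convergence[where w = "\<lambda>_. 1"])
    show "(\<lambda>y. lim (\<lambda>n. a n y)) \<in> borel_measurable \<mu>"
      by (rule borel_measurable_lim_metric[OF meas])
    show "AE y in \<mu>. (\<lambda>n. a n y) \<longlonglongrightarrow> lim (\<lambda>n. a n y)"
      using conv by eventually_elim (simp add: convergent_LIMSEQ_iff)
    have "\<bar>a n y\<bar> \<le> 1" for n y
    proof -
      have "(\<Sum>i<n. indicat_real ((F ^^ i) -` C) y) \<le> (\<Sum>i<n. 1)"
        by (intro sum_mono) (simp add: indicator_def)
      moreover have "0 \<le> (\<Sum>i<n. indicat_real ((F ^^ i) -` C) y)"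
        by (intro sum_nonneg) simp
      ultimately show ?thesis by (simp add: a_def abs_mult divide_simps)
    qed
    then show "AE y in \<mu>. norm (a n y) \<le> 1" for n by simp
  qed (use meas in auto)
  then show ?thesis by (simp add: int convergent_def) blast
qed

theorem theorem2p1:
  fixes F :: "'a::{finite, discrete_topology} config \<Rightarrow> 'a config"
    and \<mu> :: "'a config measure"
  assumes "cellular_automaton F"
    and "borel_probability \<mu>"
    and "shift_ergodic \<mu>"
    and "\<exists>x. mu_equicontinuous \<mu> F x"
  shows "\<exists>\<mu>\<^sub>c. borel_probability \<mu>\<^sub>c \<and> vaguely_converges (mean_measure \<mu> F) \<mu>\<^sub>c
    \<and> invariant_measure F \<mu>\<^sub>c"
proof -
  interpret prob_space \<mu> using assms by (simp add: borel_probability_def)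
  have space: "space \<mu> = UNIV"
    using sets_eq_imp_space_eq[of \<mu> borel] assms by (simp add: borel_probability_def)
  have cont: "continuous_on UNIV F"
    using assms by (auto simp: cellular_automaton_def)
  let ?M = "mean_measure \<mu> F"
  note mean = measure_mean_measure[OF assms(2) cont]
  have space_M: "space (?M n) = UNIV" for n
    using sets_eq_imp_space_eq[OF sets_mean_measure] by simp
  have M: "finite_measure (?M n)" for n
    by (rule finite_measureI) (use mean(2)[of UNIV n] space_M in simp)
  have M_UNIV: "measure (?M n) UNIV = 1" if "n > 0" for n
    using that prob_space by (simp add: mean(1) space)
  \<comment> \<open>The candidate for the values of the limit measure on clopen sets; finite
    additivity and total mass 1 pass to the limit.\<close>
  define L where "L C = lim (\<lambda>n. measure (?M n) C)" for C
  have lim: "(\<lambda>n. measure (?M n) C) \<longlonglongrightarrow> L C" if "C \<in> clopens" for C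
    unfolding L_def convergent_LIMSEQ_iff[symmetric]
    using assms that mean_measure_clopen_convergent by blast
  have "\<exists>\<nu>. borel_probability \<nu> \<and> (\<forall>C\<in>clopens. measure \<nu> C = L C)"
  proof (rule clopen_content_extends)
    show "0 \<le> L C" if "C \<in> clopens" for C
      by (rule LIMSEQ_le_const[OF lim[OF that]]) simp
    show "L (C \<union> D) = L C + L D" if CD: "C \<in> clopens" "D \<in> clopens" "C \<inter> D = {}" for C D
    proof (rule LIMSEQ_unique)
      show "(\<lambda>n. measure (?M n) (C \<union> D)) \<longlonglongrightarrow> L (C \<union> D)"
        using CD clopens_algebra by (intro lim) (auto simp: algebra_iff_Un)
      have "measure (?M n) (C \<union> D) = measure (?M n) C + measure (?M n) D" for n
        using CD clopens_subset_borel by (intro finite_measure.finite_measure_Union[OF M]) auto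
      then show "(\<lambda>n. measure (?M n) (C \<union> D)) \<longlonglongrightarrow> L C + L D"
        using CD by (simp add: tendsto_add lim)
    qed
    show "L UNIV = 1"
    proof (rule LIMSEQ_unique)
      show "(\<lambda>n. measure (?M n) UNIV) \<longlonglongrightarrow> L UNIV"
        by (rule lim) (simp add: clopens_def)
      show "(\<lambda>n. measure (?M n) UNIV) \<longlonglongrightarrow> 1"
        \<comment> \<open>The mass is 1 only from index 1 on, as the average of no measures is
          zero.\<close>
        by (rule tendsto_eventually) (auto simp: eventually_sequentially M_UNIV intro!: exI[of _ 1])
    qed
  qed
  then obtain \<nu> where \<nu>: "borel_probability \<nu>" "\<And>C. C \<in> clopens \<Longrightarrow> measure \<nu> C = L C"
    by blast
  have "vaguely_converges ?M \<nu>"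
  proof (rule vaguely_converges_clopensI)
    show "measure (?M n) UNIV \<le> 1" for n
      by (cases "n = 0") (simp_all add: M_UNIV, simp add: mean(1))
  qed (use M \<nu> lim in auto)
  moreover have "invariant_measure F \<nu>"
  proof (rule invariant_measure_clopensI[OF cont \<nu>(1)])
    fix C :: "'a config set" assume C: "C \<in> clopens"
    note FC = clopens_vimage[OF cont C]
    define c where "c i = measure \<mu> ((F ^^ i) -` C)" for i
    \<comment> \<open>Passing to the preimage advances the sum by one time step, so all but the two
      end terms cancel. What remains is at most \<open>1 / real n\<close> in absolute value, which
      makes the limit invariant.\<close>
    have diff: "measure (?M n) (F -` C) - measure (?M n) C = (c n - c 0) * (1 / real n)" for n
    proof -
      have "measure (?M n) (F -` C) = 1 / real n * (\<Sum>i<n. c (Suc i))"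
        by (simp add: mean(1)[OF clopens_subset_borel[OF FC]] c_def vimage_comp flip: funpow_swap1)
      moreover have "measure (?M n) C = 1 / real n * (\<Sum>i<n. c i)"
        by (simp add: mean(1)[OF clopens_subset_borel[OF C]] c_def)
      moreover have "(\<Sum>i<n. c (Suc i)) - (\<Sum>i<n. c i) = c n - c 0"
        by (simp add: sum_lessThan_telescope flip: sum_subtractf)
      ultimately show ?thesis
        by (metis mult.commute right_diff_distrib)
    qed
    have "(\<lambda>n. (c n - c 0) * (1 / real n)) \<longlonglongrightarrow> 0"
    proof (rule Lim_null_comparison[OF always_eventually lim_1_over_n], rule allI)
      fix n
      have "\<bar>c n - c 0\<bar> \<le> 1"
        using prob_le_1[of "(F ^^ n) -` C"] prob_le_1[of "(F ^^ 0) -` C"]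
          measure_nonneg[of \<mu> "(F ^^ n) -` C"] measure_nonneg[of \<mu> "(F ^^ 0) -` C"]
        unfolding c_def by linarith
      then show "norm ((c n - c 0) * (1 / real n)) \<le> 1 / real n"
        by (simp add: abs_mult divide_right_mono)
    qed
    moreover have "(\<lambda>n. measure (?M n) (F -` C) - measure (?M n) C) \<longlonglongrightarrow> L (F -` C) - L C"
      by (intro tendsto_diff lim C FC)
    ultimately have "L (F -` C) - L C = 0"
      unfolding diff by (metis LIMSEQ_unique)
    then show "measure \<nu> (F -` C) = measure \<nu> C"
      by (simp add: \<nu>(2) C FC)
  qed
  ultimately show ?thesis using \<nu>(1) by blast
qed

end
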